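(* Let $p\ge5$ be an odd prime. Let $V$ be the $(r+1)\times(r+1)$ Vandermonde matrix with entries $V_{jk}=\theta_j^{k}$, $0\le j,k\le r$. Then $V^{-1}SV$ and $V^{-1}TV$ both have all their entries in $\mathcal{O}$.
   Context: Let $r=\frac{p-1}{2}$, $\zeta_n=e^{2\pi i/n}$, $\zeta=\zeta_p$, $\theta_j=\zeta^{rj^2}$ for $j\in\mathbb{Z}$ (so $\theta_0=1$). Let $\mathcal{O}=\mathbb{Z}[\zeta_{4p}]$ if $p\equiv3\pmod4$ and $\mathcal{O}=\mathbb{Z}[\zeta_p]$ if $p\equiv1\pmod4$. Matrices are $(r+1)\times(r+1)$ with indices running from $0$ to $r$. The matrix $S$ is given by $S_{00}=\frac{1}{\sqrt p}$, $S_{0k}=\frac{2}{\sqrt p}$ for $1\le k\le r$, $S_{j0}=\frac{1}{\sqrt p}$ for $1\le j\le r$, and $S_{jk}=\frac{1}{\sqrt p}(\zeta^{jk}+\zeta^{-jk})$ for $1\le j,k\le r$. The matrix $T$ is $\mathrm{diag}(1,\theta_1,\dots,\theta_r)$. *)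

theory Defs
  imports
    Complex_Main
    "HOL-Computational_Algebra.Polynomial"
    "HOL-Computational_Algebra.Primes"
    "Jordan_Normal_Form.Matrix"
begin

definition zeta :: "nat \<Rightarrow> complex" where
  "zeta n = exp (2 * of_real pi * \<i> / of_nat n)"

definition half_pred :: "nat \<Rightarrow> nat" where
  "half_pred p = (p - 1) div 2"

definition theta :: "nat \<Rightarrow> int \<Rightarrow> complex" where
  "theta p j = zeta p powi (int (half_pred p) * j^2)"

definition int_adjoin :: "complex \<Rightarrow> complex set" where
  "int_adjoin a = range (\<lambda>q :: int poly. poly (map_poly of_int q) a)"

text \<open>Only odd \<open>p\<close> matter here, so the second case means \<open>p mod 4 = 1\<close>.\<close>

definition coeff_ring :: "nat \<Rightarrow> complex set" where
  "coeff_ring p = (if p mod 4 = 3 then int_adjoin (zeta (4 * p)) else int_adjoin (zeta p))"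

definition S_mat :: "nat \<Rightarrow> complex mat" where
  "S_mat p = mat (half_pred p + 1) (half_pred p + 1) (\<lambda>(j, k).
     if k = 0 then 1 / of_real (sqrt (of_nat p))
     else if j = 0 then 2 / of_real (sqrt (of_nat p))
     else 1 / of_real (sqrt (of_nat p)) *
       (zeta p powi (int j * int k) + zeta p powi (- (int j * int k))))"

definition T_mat :: "nat \<Rightarrow> complex mat" where
  "T_mat p = mat_diag (half_pred p + 1) (\<lambda>j. if j = 0 then 1 else theta p (int j))"

definition V_mat :: "nat \<Rightarrow> complex mat" where
  "V_mat p = mat (half_pred p + 1) (half_pred p + 1) (\<lambda>(j, k). theta p (int j) ^ k)"

end

theory Submission
  imports
    Defs
    "Jordan_Normal_Form.Determinant"
    "HOL-Number_Theory.Euler_Criterion"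
begin

text \<open>
  A column of \<open>V\<inverse> * A\<close> consists of the coefficients of the polynomial of degree at most \<open>r\<close>
  that takes the entries of the corresponding column of \<open>A\<close> as its values at the nodes
  \<open>theta p j\<close>. It therefore suffices to interpolate the columns of \<open>S * V\<close> and \<open>T * V\<close> by
  polynomials with coefficients in the ring (\<open>elements_inverse_vandermonde_times\<close>).

  Columns of the form \<open>theta p j ^ m\<close> cause no trouble: reduce \<open>X ^ m\<close> modulo the monic
  polynomial with roots \<open>theta p j\<close> (\<open>reduce_monomial\<close>). All columns of \<open>T * V\<close> have this form.
  The entries of \<open>S * V\<close> are quadratic exponential sums divided by \<open>sqrt p\<close>
  (\<open>S_times_V_entry\<close>). For \<open>k \<ge> 1\<close>, completing the square turns column \<open>k\<close> into
  \<open>theta p j ^ m\<close> times a quadratic Gauss sum over \<open>sqrt p\<close>. That factor is a fourth root of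
  unity, real precisely if \<open>p mod 4 = 1\<close>, and so lies in the ring (\<open>gauss_sum_square\<close>,
  \<open>div_sqrt_p_in_coeff_ring\<close>).

  Column \<open>0\<close> of \<open>S * V\<close> is \<open>sqrt p\<close> times the first unit vector. Its interpolating polynomial
  is the product of the \<open>X - theta p j\<close> over \<open>1 \<le> j \<le> r\<close>, scaled by \<open>sqrt p\<close> divided by the
  product of the \<open>1 - theta p j\<close>. The scaling factor is integral because \<open>sqrt p\<close> is, up to
  a fourth root of unity, the product of the \<open>zeta p ^ j - zeta p ^ (-j)\<close>
  (\<open>sine_product_square\<close>), and each of these is divisible by \<open>1 - theta p j\<close>
  (\<open>sqrt_p_div_in_coeff_ring\<close>).
\<close>

section \<open>Interpolation with coefficients in a subring\<close>

locale subring_carrier =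
  fixes R :: "'a :: comm_ring_1 set"
  assumes one_closed: "1 \<in> R"
    and diff_closed: "a \<in> R \<Longrightarrow> b \<in> R \<Longrightarrow> a - b \<in> R"
    and mult_closed: "a \<in> R \<Longrightarrow> b \<in> R \<Longrightarrow> a * b \<in> R"
begin

lemma zero_closed: "0 \<in> R"
  using diff_closed[OF one_closed one_closed] by simp

lemma uminus_closed: "a \<in> R \<Longrightarrow> - a \<in> R"
  using diff_closed[OF zero_closed] by force

lemma add_closed: "a \<in> R \<Longrightarrow> b \<in> R \<Longrightarrow> a + b \<in> R"
  using diff_closed[of a "- b"] uminus_closed[of b] by simp

lemma power_closed: "a \<in> R \<Longrightarrow> a ^ n \<in> R"
  by (induction n) (auto intro: one_closed mult_closed)

lemma sum_closed: "(\<And>i. i \<in> I \<Longrightarrow> f i \<in> R) \<Longrightarrow> sum f I \<in> R"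
  by (induction I rule: infinite_finite_induct) (auto intro: zero_closed add_closed)

lemma prod_closed: "(\<And>i. i \<in> I \<Longrightarrow> f i \<in> R) \<Longrightarrow> prod f I \<in> R"
  by (induction I rule: infinite_finite_induct) (auto intro: one_closed mult_closed)

definition polys_over :: "'a poly set" where
  "polys_over = {f. \<forall>i. poly.coeff f i \<in> R}"

lemma polys_overD: "f \<in> polys_over \<Longrightarrow> poly.coeff f i \<in> R"
  by (simp add: polys_over_def)

lemma pCons_over: "a \<in> R \<Longrightarrow> f \<in> polys_over \<Longrightarrow> pCons a f \<in> polys_over"
  by (auto simp: polys_over_def coeff_pCons split: nat.split)

lemma diff_over: "f \<in> polys_over \<Longrightarrow> g \<in> polys_over \<Longrightarrow> f - g \<in> polys_over"
  by (auto simp: polys_over_def intro: diff_closed)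

lemma smult_over: "a \<in> R \<Longrightarrow> f \<in> polys_over \<Longrightarrow> Polynomial.smult a f \<in> polys_over"
  by (auto simp: polys_over_def intro: mult_closed)

lemma mult_over: "f \<in> polys_over \<Longrightarrow> g \<in> polys_over \<Longrightarrow> f * g \<in> polys_over"
  by (auto simp: polys_over_def coeff_mult intro: mult_closed sum_closed)

lemma one_over: "1 \<in> polys_over"
  by (auto simp: polys_over_def coeff_1 intro: zero_closed one_closed)

lemma zero_over: "0 \<in> polys_over"
  by (auto simp: polys_over_def intro: zero_closed)

lemma prod_linear_over:
  "(\<And>i. i \<in> I \<Longrightarrow> x i \<in> R) \<Longrightarrow> (\<Prod>i\<in>I. [:- x i, 1:]) \<in> polys_over"
  by (induction I rule: infinite_finite_induct)
     (auto intro!: one_over mult_over pCons_over uminus_closed one_closed zero_over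
       simp del: mult_pCons_left)

end

lemma degree_prod_linear:
  fixes x :: "'i \<Rightarrow> 'a :: idom"
  assumes "finite I"
  shows "degree (\<Prod>i\<in>I. [:- x i, 1:]) = card I"
  using assms by (subst degree_prod_eq_sum_degree) auto

lemma lead_coeff_prod_linear:
  fixes x :: "'i \<Rightarrow> 'a :: idom"
  shows "lead_coeff (\<Prod>i\<in>I. [:- x i, 1:]) = 1"
  by (induction I rule: infinite_finite_induct) (auto simp: lead_coeff_mult simp del: mult_pCons_left)

text \<open>The remainder of \<open>X ^ m\<close> modulo the monic polynomial \<open>M\<close> with roots \<open>x j\<close>. Since
  \<open>M\<close> is monic, the division needs no inverses and stays inside \<open>R\<close>; an interpolation
  formula would introduce denominators \<open>x i - x j\<close>.\<close>

lemma reduce_monomial: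
  fixes x :: "nat \<Rightarrow> 'a :: idom"
  assumes "subring_carrier R" and x: "\<And>j. j < n \<Longrightarrow> x j \<in> R" and n: "n > 0"
  shows "\<exists>f. f \<in> subring_carrier.polys_over R \<and> degree f < n \<and> (\<forall>j<n. poly f (x j) = x j ^ m)"
proof -
  interpret subring_carrier R by fact
  define M where "M = (\<Prod>j\<in>{..<n}. [:- x j, 1:])"
  have M: "M \<in> polys_over" "degree M = n" "poly.coeff M n = 1"
    using degree_prod_linear[of "{..<n}" x] lead_coeff_prod_linear[of x "{..<n}"] prod_linear_over[of "{..<n}" x] x
    by (auto simp: M_def)
  have root: "poly M (x j) = 0" if "j < n" for j
    using that by (auto simp: M_def poly_prod)
  show ?thesis
  proof (induction m)
    case 0
    show ?case by (rule exI[of _ 1]) (use n one_over in auto)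
  next
    case (Suc m)
    then obtain f where f: "f \<in> polys_over" "degree f < n" "\<And>j. j < n \<Longrightarrow> poly f (x j) = x j ^ m"
      by blast
    define a where "a = poly.coeff f (n - 1)"
    \<comment> \<open>Multiplication by \<open>X\<close>, followed by cancellation of the new term of degree \<open>n\<close>.\<close>
    define g where "g = pCons 0 f - Polynomial.smult a M"
    have "a \<in> R" using f(1) polys_overD by (simp add: a_def)
    hence "g \<in> polys_over"
      unfolding g_def by (intro diff_over pCons_over smult_over f M zero_closed)
    moreover have "degree g < n"
    proof -
      have "degree g \<le> n"
        unfolding g_def
        by (rule degree_diff_le) (use f(2) M(2) in \<open>auto intro: order_trans[OF degree_pCons_le] order_trans[OF degree_smult_le]\<close>)
      moreover have "poly.coeff g n = 0"
        using n M(3) by (auto simp: g_def a_def coeff_pCons split: nat.split)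
      ultimately show ?thesis
        using n eq_zero_or_degree_less[of g n] by auto
    qed
    moreover have "poly g (x j) = x j ^ Suc m" if "j < n" for j
      using that f(3) root by (simp add: g_def)
    ultimately show ?case by blast
  qed
qed

definition vandermonde :: "nat \<Rightarrow> (nat \<Rightarrow> 'a) \<Rightarrow> 'a :: field mat" where
  "vandermonde n x = mat n n (\<lambda>(j, k). x j ^ k)"

lemma vandermonde_carrier: "vandermonde n x \<in> carrier_mat n n"
  by (simp add: vandermonde_def)

definition coeff_columns :: "nat \<Rightarrow> (nat \<Rightarrow> 'a poly) \<Rightarrow> 'a :: field mat" where
  "coeff_columns n f = mat n n (\<lambda>(i, k). poly.coeff (f k) i)"

lemma coeff_columns_carrier: "coeff_columns n f \<in> carrier_mat n n"
  by (simp add: coeff_columns_def)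

lemma vandermonde_times_coeff_columns:
  assumes "\<And>k. k < n \<Longrightarrow> degree (f k) < n"
  shows "vandermonde n x * coeff_columns n f = mat n n (\<lambda>(j, k). poly (f k) (x j))"
proof (rule eq_matI, goal_cases)
  case (1 j k)
  hence jk: "j < n" "k < n" by auto
  have "(vandermonde n x * coeff_columns n f) $$ (j, k) = (\<Sum>i = 0..<n. poly.coeff (f k) i * x j ^ i)"
    using jk by (auto simp: vandermonde_def coeff_columns_def scalar_prod_def mult.commute)
  also have "\<dots> = (\<Sum>i\<le>degree (f k). poly.coeff (f k) i * x j ^ i)"
    by (rule sum.mono_neutral_right) (use assms[OF jk(2)] in \<open>auto simp: not_le coeff_eq_0\<close>)
  finally show ?case using jk by (simp add: poly_altdef)
qed (auto simp: vandermonde_def coeff_columns_def)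

definition lagrange_basis :: "nat \<Rightarrow> (nat \<Rightarrow> 'a) \<Rightarrow> nat \<Rightarrow> 'a :: field poly" where
  "lagrange_basis n x k =
     Polynomial.smult (inverse (\<Prod>m\<in>{..<n} - {k}. x k - x m)) (\<Prod>m\<in>{..<n} - {k}. [:- x m, 1:])"

lemma degree_lagrange_basis: "k < n \<Longrightarrow> degree (lagrange_basis n x k) < n"
  unfolding lagrange_basis_def
  by (rule le_less_trans[OF degree_smult_le]) (simp add: degree_prod_linear)

lemma poly_lagrange_basis:
  assumes "inj_on x {..<n}" "j < n" "k < n"
  shows "poly (lagrange_basis n x k) (x j) = (if j = k then 1 else 0)"
proof (cases "j = k")
  case True
  have "(\<Prod>m\<in>{..<n} - {k}. x k - x m) \<noteq> 0"
    using assms by (auto simp: inj_on_def)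
  thus ?thesis using True by (simp add: lagrange_basis_def poly_prod)
next
  case False
  thus ?thesis using assms by (auto simp: lagrange_basis_def poly_prod)
qed

lemma vandermonde_inverse:
  assumes "inj_on x {..<n}"
  obtains W where "W \<in> carrier_mat n n"
    "vandermonde n x * W = 1\<^sub>m n" "W * vandermonde n x = 1\<^sub>m n"
proof -
  let ?W = "coeff_columns n (lagrange_basis n x)"
  have "vandermonde n x * ?W = 1\<^sub>m n"
    by (subst vandermonde_times_coeff_columns)
       (use assms in \<open>auto simp: degree_lagrange_basis poly_lagrange_basis intro!: eq_matI\<close>)
  thus thesis
    using that coeff_columns_carrier mat_mult_left_right_inverse[OF vandermonde_carrier coeff_columns_carrier]
    by blast
qed

text \<open>Multiplication by the inverse of a Vandermonde matrix turns the values of a polynomial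
  at the nodes into its coefficients. Integrality of \<open>W * A\<close> is thus an interpolation
  problem for each column of \<open>A\<close>, and \<open>W\<close> never has to be computed.\<close>

lemma elements_inverse_vandermonde_times:
  assumes "subring_carrier R"
    and W: "W \<in> carrier_mat n n" "W * vandermonde n x = 1\<^sub>m n"
    and A: "A \<in> carrier_mat n n"
    and f: "\<And>k. k < n \<Longrightarrow> \<exists>f. f \<in> subring_carrier.polys_over R \<and> degree f < n \<and>
              (\<forall>j<n. A $$ (j, k) = poly f (x j))"
  shows "elements_mat (W * A) \<subseteq> R"
proof -
  interpret subring_carrier R by fact
  obtain g where g: "\<And>k. k < n \<Longrightarrow> g k \<in> polys_over" "\<And>k. k < n \<Longrightarrow> degree (g k) < n"
      "\<And>j k. j < n \<Longrightarrow> k < n \<Longrightarrow> A $$ (j, k) = poly (g k) (x j)"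
    using f by metis
  have "A = vandermonde n x * coeff_columns n g"
    by (subst vandermonde_times_coeff_columns) (use g A in \<open>auto intro!: eq_matI\<close>)
  hence "W * A = (W * vandermonde n x) * coeff_columns n g"
    using W(1) by (simp add: assoc_mult_mat[OF _ vandermonde_carrier coeff_columns_carrier])
  hence "W * A = coeff_columns n g"
    using W(2) coeff_columns_carrier[of n g] by simp
  thus ?thesis
    using polys_overD[OF g(1)] by (auto simp: elements_mat_def coeff_columns_def)
qed

section \<open>Exponential sums modulo an odd prime\<close>

locale odd_prime =
  fixes p :: nat
  assumes prime_p: "prime p" and odd_p: "odd p"
begin

abbreviation r :: nat where "r \<equiv> half_pred p"

definition e :: "int \<Rightarrow> complex" where
  "e k = zeta p powi k"

lemma p_eq: "p = 2 * r + 1"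
  using odd_p by (auto simp: half_pred_def elim: oddE)

lemma p_gt_2: "p > 2"
  using prime_p odd_p prime_ge_2_nat[of p] by (cases "p = 2") auto

lemma p_pos: "p > 0"
  using p_gt_2 by simp

lemma r_pos: "r > 0"
  using p_gt_2 p_eq by linarith

lemma prime_int_p: "prime (int p)"
  using prime_p by simp

lemma zeta_nonzero: "zeta p \<noteq> 0"
  by (simp add: zeta_def)

lemma e_0: "e 0 = 1"
  by (simp add: e_def)

lemma e_add: "e (a + b) = e a * e b"
  by (simp add: e_def power_int_add zeta_nonzero)

lemma e_nonzero: "e a \<noteq> 0"
  by (simp add: e_def zeta_nonzero)

lemma e_minus: "e (- a) = inverse (e a)"
  by (simp add: e_def power_int_minus)

lemma e_mult_nat: "e (a * int n) = e a ^ n"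
  by (simp add: e_def power_int_mult)

lemma zeta_power: "zeta p ^ k = cis (2 * pi * real k / real p)"
  by (simp add: zeta_def cis_conv_exp mult_ac flip: exp_of_nat_mult)

lemma zeta_power_p: "zeta p ^ p = 1"
  using p_pos by (simp add: zeta_power)

lemma e_period: "e (a * int p) = 1"
  by (metis e_def mult.commute power_int_mult power_int_of_nat zeta_power_p power_int_1_left)

lemma e_mod: "e (a mod int p) = e a"
  by (metis e_add e_period mod_div_mult_eq mult_1_right)

lemma e_eq_1_iff: "e a = 1 \<longleftrightarrow> int p dvd a"
proof
  assume "int p dvd a"
  thus "e a = 1" using e_mod[of a] by (simp add: e_0)
next
  assume *: "e a = 1"
  define k where "k = nat (a mod int p)"
  have k: "k < p" "int k = a mod int p"
    using p_pos by (auto simp: k_def nat_less_iff)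
  have "zeta p ^ k = zeta p ^ 0"
    using * e_mod[of a] k(2) by (simp add: e_def flip: power_int_of_nat)
  hence "k = 0"
    using bij_betw_roots_unity[OF p_pos] k(1) p_pos
    by (auto simp: bij_betw_def inj_on_def zeta_power)
  thus "int p dvd a" using k by auto
qed

lemma e_eq_iff: "e a = e b \<longleftrightarrow> int p dvd a - b"
proof -
  have "e a = e b \<longleftrightarrow> e (a - b) = 1"
    using e_add[of b "a - b"] e_nonzero[of b] by auto
  thus ?thesis by (simp add: e_eq_1_iff)
qed

lemma e_cong: "[a = b] (mod int p) \<Longrightarrow> e a = e b"
  by (simp add: e_eq_iff cong_iff_dvd_diff)

lemma theta_eq: "theta p j = e (int r * j\<^sup>2)"
  by (simp add: theta_def e_def)

definition periodic :: "(int \<Rightarrow> 'a) \<Rightarrow> bool" where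
  "periodic F \<longleftrightarrow> (\<forall>l. F (l mod int p) = F l)"

lemma periodicI:
  assumes "\<And>a b. [a = b] (mod int p) \<Longrightarrow> F a = F b"
  shows "periodic F"
  unfolding periodic_def using assms by (metis cong_mod_left cong_refl)

lemma bij_betw_affine:
  assumes "\<not> int p dvd u"
  shows "bij_betw (\<lambda>l. (u * l + c) mod int p) {0..<int p} {0..<int p}"
proof -
  have "inj_on (\<lambda>l. (u * l + c) mod int p) {0..<int p}"
  proof (rule inj_onI)
    fix a b assume ab: "a \<in> {0..<int p}" "b \<in> {0..<int p}"
      and eq: "(u * a + c) mod int p = (u * b + c) mod int p"
    have "int p dvd (u * a + c) - (u * b + c)"
      using eq by (simp add: mod_eq_dvd_iff)
    hence "int p dvd u * (a - b)" by (simp add: algebra_simps)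
    hence "int p dvd a - b" using assms prime_int_p prime_dvd_mult_iff by blast
    hence "a mod int p = b mod int p" by (simp add: mod_eq_dvd_iff)
    thus "a = b" using ab by simp
  qed
  moreover have "(\<lambda>l. (u * l + c) mod int p) ` {0..<int p} \<subseteq> {0..<int p}"
    using p_pos by auto
  ultimately show ?thesis
    unfolding bij_betw_def using endo_inj_surj[of "{0..<int p}"] by auto
qed

lemma sum_affine:
  assumes "periodic F" "\<not> int p dvd u"
  shows "(\<Sum>l\<in>{0..<int p}. F (u * l + c)) = (\<Sum>l\<in>{0..<int p}. F l)"
  using sum.reindex_bij_betw[OF bij_betw_affine[OF assms(2), of c], of F] assms(1)
  by (simp add: periodic_def)

lemma sum_shift:
  assumes "periodic F"
  shows "(\<Sum>l\<in>{0..<int p}. F (l + c)) = (\<Sum>l\<in>{0..<int p}. F l)"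
  using sum_affine[OF assms, of 1 c] p_gt_2 by (simp add: zdvd1_eq)

lemma prod_dilate:
  assumes "periodic F" "\<not> int p dvd u"
  shows "(\<Prod>l\<in>{1..<int p}. F (u * l)) = (\<Prod>l\<in>{1..<int p}. F l)"
proof -
  have eq: "{1..<int p} = {0..<int p} - {0}" by auto
  have "bij_betw (\<lambda>l. u * l mod int p) ({0..<int p} - {0}) ({0..<int p} - {0})"
    using bij_betw_DiffI[OF bij_betw_affine[OF assms(2), of 0], of "{0}" "{0}"] p_pos
    by (simp add: bij_betw_singleton_iff)
  hence "bij_betw (\<lambda>l. u * l mod int p) {1..<int p} {1..<int p}"
    by (simp add: eq)
  from prod.reindex_bij_betw[OF this, of F] show ?thesis
    using assms(1) by (simp add: periodic_def)
qed

lemma nonzero_residues: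
  "{1..<int p} = int ` {1..r} \<union> (\<lambda>l. int p - int l) ` {1..r}"
proof (intro equalityI subsetI)
  fix x assume x: "x \<in> {1..<int p}"
  show "x \<in> int ` {1..r} \<union> (\<lambda>l. int p - int l) ` {1..r}"
  proof (cases "x \<le> int r")
    case True
    thus ?thesis using x by (auto intro!: image_eqI[of _ _ "nat x"])
  next
    case False
    have "x = int p - int (nat (int p - x))" "nat (int p - x) \<in> {1..r}"
      using False x p_eq by auto
    thus ?thesis by blast
  qed
qed (use p_eq in auto)

lemma nonzero_residues_disjoint: "int ` {1..r} \<inter> (\<lambda>l. int p - int l) ` {1..r} = {}"
  using p_eq by auto

lemma periodic_reflect: "periodic F \<Longrightarrow> F (int p - l) = F (- l)"
  unfolding periodic_def by (metis mod_add_self1 uminus_add_conv_diff add.commute)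

lemma sum_fold:
  assumes "periodic F"
  shows "(\<Sum>l\<in>{0..<int p}. F l) = F 0 + (\<Sum>l\<in>{1..r}. F (int l) + F (- int l))"
proof -
  have "{0..<int p} = insert 0 {1..<int p}" using p_pos by auto
  hence "(\<Sum>l\<in>{0..<int p}. F l) = F 0 + (\<Sum>l\<in>{1..<int p}. F l)" by simp
  also have "(\<Sum>l\<in>{1..<int p}. F l) = (\<Sum>l\<in>{1..r}. F (int l)) + (\<Sum>l\<in>{1..r}. F (int p - int l))"
    unfolding nonzero_residues
    by (subst sum.union_disjoint)
       (use nonzero_residues_disjoint in \<open>auto simp: sum.reindex inj_on_def\<close>)
  finally show ?thesis by (simp add: periodic_reflect[OF assms] sum.distrib)
qed

lemma prod_fold:
  assumes "periodic F"
  shows "(\<Prod>l\<in>{1..<int p}. F l) = (\<Prod>l\<in>{1..r}. F (int l) * F (- int l))"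
proof -
  have "(\<Prod>l\<in>{1..<int p}. F l) = (\<Prod>l\<in>{1..r}. F (int l)) * (\<Prod>l\<in>{1..r}. F (int p - int l))"
    unfolding nonzero_residues
    by (subst prod.union_disjoint)
       (use nonzero_residues_disjoint in \<open>auto simp: prod.reindex inj_on_def\<close>)
  thus ?thesis by (simp add: periodic_reflect[OF assms] prod.distrib)
qed

lemma sum_e: "(\<Sum>l\<in>{0..<int p}. e (a * l)) = (if int p dvd a then of_nat p else 0)"
proof (cases "int p dvd a")
  case True
  hence "e (a * l) = 1" for l by (simp add: e_eq_1_iff)
  thus ?thesis using True by simp
next
  case False
  have per: "periodic (\<lambda>l. e (a * l))"
    by (intro periodicI e_cong cong_mult cong_refl)
  have "e a * (\<Sum>l\<in>{0..<int p}. e (a * l)) = (\<Sum>l\<in>{0..<int p}. e (a * (l + 1)))"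
    by (simp add: sum_distrib_left e_add distrib_left mult.commute)
  also have "\<dots> = (\<Sum>l\<in>{0..<int p}. e (a * l))"
    by (rule sum_shift[OF per])
  finally have "(e a - 1) * (\<Sum>l\<in>{0..<int p}. e (a * l)) = 0"
    by (simp add: algebra_simps)
  thus ?thesis using False by (simp add: e_eq_1_iff)
qed

text \<open>The value at \<open>1\<close> of \<open>1 + X + \<dots> + X ^ (p - 1)\<close>, whose roots are the nontrivial \<open>p\<close>-th
  roots of unity.\<close>

lemma prod_one_minus_e: "(\<Prod>l\<in>{1..<int p}. 1 - e l) = of_nat p"
proof -
  define f :: "complex poly" where "f = (\<Sum>i<p. Polynomial.monom 1 i)"
  define g :: "complex poly" where "g = (\<Prod>l\<in>{1..<int p}. [:- e l, 1:])"
  have inj: "inj_on e {1..<int p}"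
  proof (rule inj_onI)
    fix a b assume ab: "a \<in> {1..<int p}" "b \<in> {1..<int p}" "e a = e b"
    hence "a mod int p = b mod int p" by (simp only: e_eq_iff mod_eq_dvd_iff)
    thus "a = b" using ab by simp
  qed
  have "f = g"
  proof (rule poly_eqI_degree_lead_coeff[of _ "p - 1" _ "e ` {1..<int p}"])
    have deg_g: "degree g = p - 1"
      by (simp add: g_def degree_prod_linear nat_diff_distrib)
    have "poly.coeff f (p - 1) = 1"
      using p_pos by (simp add: f_def coeff_sum)
    moreover have "poly.coeff g (p - 1) = 1"
      using lead_coeff_prod_linear[of e "{1..<int p}"] deg_g by (simp add: g_def)
    ultimately show "poly.coeff f (p - 1) = poly.coeff g (p - 1)" by simp
    show "card (e ` {1..<int p}) \<ge> p - 1"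
      using inj by (simp add: card_image nat_diff_distrib)
    show "degree f \<le> p - 1"
      unfolding f_def by (rule degree_sum_le) (auto intro: order_trans[OF degree_monom_le])
    show "degree g \<le> p - 1" using deg_g by simp
    fix z assume "z \<in> e ` {1..<int p}"
    then obtain l where l: "l \<in> {1..<int p}" "z = e l" by auto
    have "z \<noteq> 1" using l zdvd_imp_le[of "int p" l] by (auto simp: e_eq_1_iff)
    moreover have "z ^ p = 1"
      using e_mult_nat[of l p] e_period l(2) by simp
    ultimately have "poly f z = 0"
      by (simp add: f_def poly_sum poly_monom geometric_sum)
    moreover have "poly g z = 0" using l by (auto simp: g_def poly_prod)
    ultimately show "poly f z = poly g z" by simp
  qed
  hence "poly f 1 = poly g 1" by simp
  thus ?thesis by (simp add: f_def g_def poly_sum poly_monom poly_prod)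
qed

text \<open>This is \<open>(2 * \<i>) ^ r\<close> times the product of the \<open>sin (2 * pi * l / p)\<close>: an explicit square root
  of \<open>(-1) ^ r * p\<close> that, unlike a Gauss sum, comes factored into associates of
  \<open>1 - zeta p\<close>.\<close>

definition sine_product :: complex where
  "sine_product = (\<Prod>l\<in>{1..r}. e (int l) - e (- int l))"

lemma not_dvd_2: "\<not> int p dvd 2"
  using p_gt_2 zdvd_imp_le[of "int p" 2] by auto

text \<open>Each squared factor is \<open>- (1 - e (2 * l)) * (1 - e (- 2 * l))\<close>, and the exponents
  \<open>2 * l\<close>, \<open>- 2 * l\<close> run through all nonzero residues exactly once.\<close>

lemma sine_product_square: "sine_product\<^sup>2 = (-1) ^ r * of_nat p"
proof -
  have sq: "(e l - e (- l))\<^sup>2 = - ((1 - e (2 * l)) * (1 - e (2 * - l)))" for l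
  proof -
    have dbl: "e (2 * l) = e l ^ 2" "e (2 * - l) = e (- l) ^ 2"
      using e_mult_nat[of l 2] e_mult_nat[of "- l" 2] by (simp_all add: mult.commute)
    have unit: "e l * e (- l) = 1" by (simp add: e_minus e_nonzero)
    have *: "(x - y)\<^sup>2 = - ((1 - x\<^sup>2) * (1 - y\<^sup>2))" if "x * y = 1" for x y :: complex
    proof -
      have "(x - y)\<^sup>2 = x\<^sup>2 + y\<^sup>2 - 2 * (x * y)" by (simp add: power2_diff)
      moreover have "(1 - x\<^sup>2) * (1 - y\<^sup>2) = 1 - x\<^sup>2 - y\<^sup>2 + (x * y)\<^sup>2"
        by (simp add: power2_eq_square algebra_simps)
      ultimately show ?thesis using that by simp
    qed
    show ?thesis unfolding dbl by (rule *[OF unit])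
  qed
  have "sine_product\<^sup>2 = (\<Prod>l\<in>{1..r}. - 1 * ((1 - e (2 * int l)) * (1 - e (2 * - int l))))"
    unfolding sine_product_def prod_power_distrib by (intro prod.cong refl) (simp only: sq mult_minus1)
  also have "\<dots> = (-1) ^ r * (\<Prod>l\<in>{1..r}. (1 - e (2 * int l)) * (1 - e (2 * - int l)))"
    by (subst prod.distrib) simp
  also have "(\<Prod>l\<in>{1..r}. (1 - e (2 * int l)) * (1 - e (2 * - int l))) = (\<Prod>l\<in>{1..<int p}. 1 - e (2 * l))"
    by (subst prod_fold) (auto intro!: periodicI e_cong cong_mult cong_refl)
  also have "\<dots> = (\<Prod>l\<in>{1..<int p}. 1 - e l)"
    by (rule prod_dilate[of "\<lambda>l. 1 - e l"])
       (use not_dvd_2 in \<open>auto intro!: periodicI e_cong\<close>)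
  also have "\<dots> = of_nat p" by (rule prod_one_minus_e)
  finally show ?thesis .
qed

definition gauss_sum :: "int \<Rightarrow> complex" where
  "gauss_sum a = (\<Sum>l\<in>{0..<int p}. e (a * l\<^sup>2))"

lemma periodic_quadratic: "periodic (\<lambda>l. e (a * l\<^sup>2 + b * l + c))"
  by (intro periodicI e_cong cong_add cong_mult cong_pow cong_refl)

lemma gauss_sum_completed_square:
  assumes "[2 * a * c = b] (mod int p)"
  shows "(\<Sum>l\<in>{0..<int p}. e (a * l\<^sup>2 + b * l)) = gauss_sum a * e (- (a * c\<^sup>2))"
proof -
  have per: "periodic (\<lambda>l. e (a * l\<^sup>2))"
    using periodic_quadratic[of a 0 0] by simp
  have "e (a * l\<^sup>2 + b * l) = e (a * (l + c)\<^sup>2) * e (- (a * c\<^sup>2))" for l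
  proof -
    have "int p dvd (2 * a * c - b) * l"
      using assms by (simp add: cong_iff_dvd_diff)
    hence "int p dvd (a * (l + c)\<^sup>2 + - (a * c\<^sup>2)) - (a * l\<^sup>2 + b * l)"
      by (simp add: power2_eq_square algebra_simps)
    thus ?thesis unfolding e_add[symmetric] e_eq_iff by (subst dvd_diff_commute)
  qed
  thus ?thesis
    using sum_shift[OF per, of c] by (simp add: gauss_sum_def flip: sum_distrib_right)
qed

text \<open>The shift \<open>l \<mapsto> l + m\<close> makes the double sum linear in \<open>m\<close>, so that orthogonality leaves only
  the terms with \<open>l = 0\<close>.\<close>

lemma gauss_sum_mult_conj:
  assumes "\<not> int p dvd a"
  shows "gauss_sum a * gauss_sum (- a) = of_nat p"
proof -
  let ?Z = "{0..<int p}"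
  have per: "periodic (\<lambda>l. e (a * l\<^sup>2 + 0 * l + c))" for c
    by (rule periodic_quadratic)
  have "gauss_sum a * gauss_sum (- a) = (\<Sum>m\<in>?Z. \<Sum>l\<in>?Z. e (a * l\<^sup>2 + 0 * l + - (a * m\<^sup>2)))"
    unfolding gauss_sum_def sum_product
    by (subst sum.swap) (simp flip: e_add)
  also have "\<dots> = (\<Sum>m\<in>?Z. \<Sum>l\<in>?Z. e (a * (l + m)\<^sup>2 + 0 * (l + m) + - (a * m\<^sup>2)))"
    by (intro sum.cong refl sum_shift[symmetric] per)
  also have "\<dots> = (\<Sum>m\<in>?Z. \<Sum>l\<in>?Z. e (a * l\<^sup>2) * e (2 * a * l * m))"
    by (intro sum.cong refl, subst e_add[symmetric]) (simp add: power2_eq_square algebra_simps)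
  also have "\<dots> = (\<Sum>l\<in>?Z. e (a * l\<^sup>2) * (\<Sum>m\<in>?Z. e (2 * a * l * m)))"
    by (subst sum.swap) (simp add: sum_distrib_left)
  also have "\<dots> = (\<Sum>l\<in>?Z. if l = 0 then of_nat p else 0)"
  proof (intro sum.cong refl)
    fix l assume l: "l \<in> ?Z"
    have "int p dvd l \<longleftrightarrow> l = 0"
      using l zdvd_not_zless[of l "int p"] by (cases "l = 0") auto
    hence "int p dvd 2 * a * l \<longleftrightarrow> l = 0"
      using assms not_dvd_2 prime_int_p by (simp add: prime_dvd_mult_iff)
    thus "e (a * l\<^sup>2) * (\<Sum>m\<in>?Z. e (2 * a * l * m)) = (if l = 0 then of_nat p else 0)"
      by (simp add: sum_e e_0)
  qed
  also have "\<dots> = of_nat p" using p_pos by simp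
  finally show ?thesis .
qed

lemma QuadRes_minus_one_iff: "QuadRes (int p) (-1) \<longleftrightarrow> even r"
proof -
  have 1: "\<not> [-1 = 0] (mod int p)" "\<not> [1 = -1] (mod int p)"
    using p_gt_2 not_dvd_2 by (auto simp: cong_iff_dvd_diff zdvd1_eq)
  have "[Legendre (-1) (int p) = (-1) ^ r] (mod int p)"
    using euler_criterion[OF prime_p p_gt_2, of "-1"] by (simp add: half_pred_def)
  thus ?thesis
    using 1 by (cases "even r") (auto simp: Legendre_def cong_sym_eq split: if_splits)
qed

text \<open>If \<open>-1 = c\<^sup>2\<close> modulo \<open>p\<close>, then the substitution \<open>l \<mapsto> c * l\<close> exchanges the two Gauss sums.
  Otherwise the nonzero squares and their negatives partition the nonzero residues, so the
  two Gauss sums together count every residue twice and add up to \<open>0\<close>.\<close>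

lemma gauss_sum_uminus:
  assumes a: "\<not> int p dvd a"
  shows "gauss_sum (- a) = (-1) ^ r * gauss_sum a"
proof (cases "QuadRes (int p) (-1)")
  case True
  then obtain c where c: "[c\<^sup>2 = -1] (mod int p)" by (auto simp: QuadRes_def)
  have "\<not> int p dvd c"
  proof
    assume "int p dvd c"
    hence "[c\<^sup>2 = 0] (mod int p)" by (simp add: cong_0_iff power2_eq_square)
    with c have "[-1 = 0] (mod int p)" by (metis cong_sym cong_trans)
    thus False using p_gt_2 by (simp add: cong_iff_dvd_diff zdvd1_eq)
  qed
  have "gauss_sum a = (\<Sum>l\<in>{0..<int p}. e (a * (c * l + 0)\<^sup>2))"
    unfolding gauss_sum_def using periodic_quadratic[of a 0 0]
    by (intro sum_affine[symmetric] \<open>\<not> int p dvd c\<close>) simp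
  also have "\<dots> = gauss_sum (- a)"
    unfolding gauss_sum_def
  proof (intro sum.cong refl e_cong)
    fix l
    have "[a * l\<^sup>2 * c\<^sup>2 = a * l\<^sup>2 * (-1)] (mod int p)" using c by (intro cong_mult cong_refl)
    thus "[a * (c * l + 0)\<^sup>2 = - a * l\<^sup>2] (mod int p)" by (simp add: power_mult_distrib mult_ac)
  qed
  finally show ?thesis using True by (simp add: QuadRes_minus_one_iff)
next
  case False
  define A where "A = (\<lambda>l. (int l)\<^sup>2 mod int p) ` {1..r}"
  define B where "B = (\<lambda>l. - (int l)\<^sup>2 mod int p) ` {1..r}"
  have sq_inj: "l = m" if "l \<in> {1..r}" "m \<in> {1..r}" "int p dvd (int l)\<^sup>2 - (int m)\<^sup>2" for l m
  proof -
    have "(int l)\<^sup>2 - (int m)\<^sup>2 = (int l - int m) * (int l + int m)"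
      by (simp add: power2_eq_square algebra_simps)
    hence "int p dvd int l - int m \<or> int p dvd int l + int m"
      using that(3) prime_int_p by (simp add: prime_dvd_mult_iff)
    moreover have "\<not> int p dvd int l + int m"
      using that p_eq by (intro zdvd_not_zless) auto
    ultimately have "int l mod int p = int m mod int p" by (simp add: mod_eq_dvd_iff)
    thus ?thesis using that p_eq by simp
  qed
  have not_dvd: "\<not> int p dvd int l" if "l \<in> {1..r}" for l
    using that p_eq by (intro zdvd_not_zless) auto
  have injA: "inj_on (\<lambda>l. (int l)\<^sup>2 mod int p) {1..r}"
    by (rule inj_onI) (rule sq_inj, auto simp: mod_eq_dvd_iff)
  have injB: "inj_on (\<lambda>l. - (int l)\<^sup>2 mod int p) {1..r}"
    by (rule inj_onI) (rule sq_inj, auto simp: mod_eq_dvd_iff dvd_diff_commute)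
  have disj: "A \<inter> B = {}"
  proof (rule ccontr)
    assume "A \<inter> B \<noteq> {}"
    then obtain x where x: "x \<in> A" "x \<in> B" by blast
    obtain l where l: "l \<in> {1..r}" "x = (int l)\<^sup>2 mod int p"
      using x(1) unfolding A_def by (rule imageE)
    obtain m where m: "m \<in> {1..r}" "x = - (int m)\<^sup>2 mod int p"
      using x(2) unfolding B_def by (rule imageE)
    have lm: "l \<in> {1..r}" "m \<in> {1..r}"
        "(int l)\<^sup>2 mod int p = - (int m)\<^sup>2 mod int p"
      using l m by simp_all
    have "coprime (int m) (int p)"
      using not_dvd[OF lm(2)] prime_int_p by (meson coprime_commute prime_imp_coprime)
    then obtain k where k: "[int m * k = 1] (mod int p)" using cong_solve_coprime_int by blast
    have "[(int l * k)\<^sup>2 = - (int m)\<^sup>2 * k\<^sup>2] (mod int p)"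
      unfolding power_mult_distrib by (intro cong_mult cong_refl) (use lm(3) in \<open>simp add: cong_def\<close>)
    also have "- (int m)\<^sup>2 * k\<^sup>2 = - 1 * (int m * k)\<^sup>2" by (simp add: power_mult_distrib)
    also have "[- 1 * (int m * k)\<^sup>2 = - 1 * 1\<^sup>2] (mod int p)"
      by (intro cong_mult cong_refl cong_pow k)
    finally have "[(int l * k)\<^sup>2 = - 1] (mod int p)" by simp
    thus False using False by (auto simp: QuadRes_def)
  qed
  have sub: "A \<union> B \<subseteq> {1..<int p}"
  proof -
    have "1 \<le> x mod int p \<and> x mod int p < int p" if "\<not> int p dvd x" for x
    proof -
      have "0 \<le> x mod int p" "x mod int p < int p" using p_pos by simp_all
      moreover have "x mod int p \<noteq> 0" using that dvd_eq_mod_eq_0 by metis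
      ultimately show ?thesis by simp
    qed
    moreover have "\<not> int p dvd (int l)\<^sup>2" "\<not> int p dvd - (int l)\<^sup>2" if "l \<in> {1..r}" for l
      using not_dvd[OF that] prime_int_p by (simp_all add: prime_dvd_power_iff)
    ultimately show ?thesis unfolding A_def B_def by (auto simp del: atLeastAtMost_iff)
  qed
  have "card (A \<union> B) = card {1..<int p}"
    using injA injB disj p_eq by (subst card_Un_disjoint) (auto simp: A_def B_def card_image)
  hence AB: "A \<union> B = {1..<int p}"
    using sub by (intro card_subset_eq) auto
  have "0 = (\<Sum>l\<in>{0..<int p}. e (a * l))" using a by (simp add: sum_e)
  also have "{0..<int p} = insert 0 {1..<int p}" using p_pos by auto
  also have "(\<Sum>l\<in>insert 0 {1..<int p}. e (a * l)) = 1 + (\<Sum>l\<in>A \<union> B. e (a * l))"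
    by (simp add: AB e_0)
  also have "(\<Sum>l\<in>A \<union> B. e (a * l)) = (\<Sum>l\<in>A. e (a * l)) + (\<Sum>l\<in>B. e (a * l))"
    by (rule sum.union_disjoint[OF _ _ disj]) (simp_all add: A_def B_def)
  also have "(\<Sum>l\<in>A. e (a * l)) = (\<Sum>l\<in>{1..r}. e (a * (int l)\<^sup>2))"
    unfolding A_def sum.reindex[OF injA] o_def
    by (intro sum.cong refl e_cong) (simp add: cong_def mod_mult_right_eq)
  also have "(\<Sum>l\<in>B. e (a * l)) = (\<Sum>l\<in>{1..r}. e (- a * (int l)\<^sup>2))"
    unfolding B_def sum.reindex[OF injB] o_def
    by (intro sum.cong refl e_cong) (simp add: cong_def mod_mult_right_eq)
  finally have *: "(\<Sum>l\<in>{1..r}. e (- a * (int l)\<^sup>2)) = - 1 - (\<Sum>l\<in>{1..r}. e (a * (int l)\<^sup>2))"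
    by (simp add: eq_diff_eq eq_neg_iff_add_eq_0 add_ac)
  have fold: "gauss_sum b = 1 + 2 * (\<Sum>l\<in>{1..r}. e (b * (int l)\<^sup>2))" for b
    unfolding gauss_sum_def using periodic_quadratic[of b 0 0]
    by (subst sum_fold) (simp_all add: e_0 sum_distrib_left)
  show ?thesis
    using False unfolding fold * by (simp add: QuadRes_minus_one_iff)
qed

text \<open>The product of the conjugate sums for \<open>a\<close> and \<open>- a\<close> is \<open>p\<close>, and they differ at most in
  sign.\<close>

lemma gauss_sum_square:
  assumes "\<not> int p dvd a"
  shows "(gauss_sum a)\<^sup>2 = (-1) ^ r * of_nat p"
proof -
  have "gauss_sum a * ((-1) ^ r * gauss_sum a) = of_nat p"
    using gauss_sum_mult_conj[OF assms] gauss_sum_uminus[OF assms] by simp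
  hence "(-1) ^ r * ((-1) ^ r * (gauss_sum a)\<^sup>2) = (-1) ^ r * of_nat p"
    by (simp add: power2_eq_square mult_ac)
  thus ?thesis by simp
qed

end

section \<open>The coefficient ring\<close>

lemma subring_int_adjoin: "subring_carrier (int_adjoin a)"
proof
  show "1 \<in> int_adjoin a"
    unfolding int_adjoin_def by (rule image_eqI[of _ _ 1]) simp_all
next
  fix x y assume "x \<in> int_adjoin a" "y \<in> int_adjoin a"
  then obtain f g :: "int poly" where fg: "x = poly (map_poly of_int f) a" "y = poly (map_poly of_int g) a"
    by (auto simp: int_adjoin_def)
  have "map_poly of_int (f - g) = (map_poly of_int f - map_poly of_int g :: complex poly)"
    by (intro poly_eqI) (simp add: coeff_map_poly)
  thus "x - y \<in> int_adjoin a"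
    unfolding int_adjoin_def fg by (intro image_eqI[of _ _ "f - g"]) simp_all
  have "map_poly of_int (f * g) = (map_poly of_int f * map_poly of_int g :: complex poly)"
    by (intro poly_eqI) (simp add: coeff_map_poly coeff_mult)
  thus "x * y \<in> int_adjoin a"
    unfolding int_adjoin_def fg by (intro image_eqI[of _ _ "f * g"]) simp_all
qed

lemma generator_in_int_adjoin: "a \<in> int_adjoin a"
  unfolding int_adjoin_def by (rule image_eqI[of _ _ "[:0, 1:]"]) (simp_all add: map_poly_pCons)

context odd_prime
begin

lemma subring_coeff_ring: "subring_carrier (coeff_ring p)"
  by (simp add: coeff_ring_def subring_int_adjoin)

sublocale R: subring_carrier "coeff_ring p"
  by (rule subring_coeff_ring)

lemma zeta_in_coeff_ring: "zeta p \<in> coeff_ring p"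
proof (cases "p mod 4 = 3")
  case True
  have "zeta (4 * p) ^ 4 = zeta p"
    by (simp add: zeta_def mult_ac flip: exp_of_nat_mult)
  moreover have "zeta (4 * p) \<in> coeff_ring p"
    using True generator_in_int_adjoin by (simp add: coeff_ring_def)
  ultimately show ?thesis using R.power_closed by metis
qed (simp add: coeff_ring_def generator_in_int_adjoin)

lemma e_in_coeff_ring: "e k \<in> coeff_ring p"
proof -
  have "e k = zeta p ^ nat (k mod int p)"
    using e_mod[of k] p_pos by (simp add: e_def power_int_def)
  thus ?thesis by (simp add: R.power_closed zeta_in_coeff_ring)
qed

lemma odd_r_iff: "odd r \<longleftrightarrow> p mod 4 = 3"
  using p_eq by presburger

lemma i_in_coeff_ring:
  assumes "odd r"
  shows "\<i> \<in> coeff_ring p"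
proof -
  have "zeta (4 * p) ^ p = cis (pi / 2)"
    using p_pos by (simp add: zeta_def cis_conv_exp mult_ac flip: exp_of_nat_mult)
  also have "\<dots> = \<i>" by simp
  finally have "zeta (4 * p) ^ p = \<i>" .
  moreover have "zeta (4 * p) \<in> coeff_ring p"
    using assms generator_in_int_adjoin by (simp add: coeff_ring_def odd_r_iff)
  ultimately show ?thesis using R.power_closed by metis
qed

abbreviation sqrt_p :: complex where "sqrt_p \<equiv> of_real (sqrt (of_nat p))"

lemma sqrt_p_square: "sqrt_p\<^sup>2 = of_nat p"
  by (simp flip: of_real_power)

lemma sqrt_p_nonzero: "sqrt_p \<noteq> 0"
  using p_pos by simp

lemma div_sqrt_p_square:
  assumes "x\<^sup>2 = (-1) ^ r * of_nat p"
  shows "(x / sqrt_p)\<^sup>2 = (-1) ^ r"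
  using p_pos by (simp add: power_divide assms sqrt_p_square)

text \<open>Such a quotient is \<open>1\<close> or \<open>-1\<close> for even \<open>r\<close> and \<open>\<i>\<close> or \<open>-\<i>\<close> for odd \<open>r\<close>. The odd case,
  \<open>p mod 4 = 3\<close>, is the reason for adjoining \<open>zeta (4 * p)\<close> there.\<close>

lemma div_sqrt_p_in_coeff_ring:
  assumes "x\<^sup>2 = (-1) ^ r * of_nat p"
  shows "x / sqrt_p \<in> coeff_ring p"
proof (cases "even r")
  case True
  hence "x / sqrt_p = 1 \<or> x / sqrt_p = -1"
    using div_sqrt_p_square[OF assms] by (simp only: power2_eq_1_iff neg_one_even_power)
  thus ?thesis using R.one_closed R.uminus_closed by metis
next
  case False
  hence "(x / sqrt_p)\<^sup>2 = \<i>\<^sup>2"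
    using div_sqrt_p_square[OF assms] by simp
  hence "x / sqrt_p = \<i> \<or> x / sqrt_p = - \<i>"
    by (simp only: power2_eq_iff)
  thus ?thesis using False i_in_coeff_ring R.uminus_closed by metis
qed

lemma not_dvd_between: "0 < k \<Longrightarrow> k < p \<Longrightarrow> \<not> int p dvd int k"
  by (auto dest: dvd_imp_le)

lemma solve_cong:
  assumes "\<not> int p dvd a"
  obtains n :: nat where "[a * int n = b] (mod int p)"
proof -
  have "coprime a (int p)"
    using assms prime_int_p by (meson coprime_commute prime_imp_coprime)
  then obtain x where x: "[a * x = 1] (mod int p)" using cong_solve_coprime_int by blast
  define n where "n = nat (x * b mod int p)"
  have "int n = x * b mod int p" using p_pos by (simp add: n_def)
  hence "[a * int n = a * (x * b)] (mod int p)"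
    by (intro cong_mult cong_refl) (simp add: cong_def)
  also have "[a * (x * b) = b] (mod int p)"
    using cong_mult[OF x cong_refl[of b]] by (simp add: mult_ac)
  finally show thesis by (rule that)
qed

lemma r_not_dvd: "\<not> int p dvd int r"
  using r_pos p_eq by (intro not_dvd_between) auto

lemma theta_in_coeff_ring: "theta p j \<in> coeff_ring p"
  by (simp add: theta_eq e_in_coeff_ring)

lemma theta_0: "theta p 0 = 1"
  by (simp add: theta_eq e_0)

lemma theta_inj: "inj_on (\<lambda>j. theta p (int j)) {..<r + 1}"
proof (rule inj_onI)
  fix i j assume ij: "i \<in> {..<r + 1}" "j \<in> {..<r + 1}" and eq: "theta p (int i) = theta p (int j)"
  have "int r * (int i)\<^sup>2 - int r * (int j)\<^sup>2 = int r * ((int i - int j) * (int i + int j))"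
    by (simp add: power2_eq_square algebra_simps)
  hence "int p dvd int r * ((int i - int j) * (int i + int j))"
    using eq by (simp add: theta_eq e_eq_iff)
  hence "int p dvd int i - int j \<or> int p dvd int (i + j)"
    using r_not_dvd prime_int_p by (simp add: prime_dvd_mult_iff)
  thus "i = j"
  proof
    assume "int p dvd int i - int j"
    hence "int i mod int p = int j mod int p" by (simp only: mod_eq_dvd_iff)
    thus ?thesis using ij p_eq by simp
  next
    assume "int p dvd int (i + j)"
    moreover have "i + j < p" using ij p_eq by auto
    ultimately have "i + j = 0" using not_dvd_between[of "i + j"] by blast
    thus ?thesis by simp
  qed
qed

text \<open>Up to a root of unity the quotient is \<open>(t ^ n - 1) / (t - 1)\<close> for \<open>t = theta p j\<close>: every
  \<open>p\<close>-th root of unity is a power of \<open>t\<close>.\<close>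

lemma sine_factor_div:
  assumes j: "j \<in> {1..r}"
  shows "(e (int j) - e (- int j)) / (1 - theta p (int j)) \<in> coeff_ring p"
proof -
  let ?t = "theta p (int j)"
  have "\<not> int p dvd int r * (int j)\<^sup>2"
    using j p_eq r_not_dvd not_dvd_between[of j] prime_int_p
    by (auto simp: prime_dvd_mult_iff power2_eq_square)
  then obtain n where n: "[int r * (int j)\<^sup>2 * int n = 2 * int j] (mod int p)"
    using solve_cong by blast
  have t: "?t \<noteq> 1"
    using inj_onD[OF theta_inj, of j 0] j by (auto simp: theta_0)
  have "?t ^ n = e (2 * int j)"
    using e_cong[OF n] by (simp add: theta_eq e_mult_nat)
  hence "e (int j) - e (- int j) = e (- int j) * (?t ^ n - 1)"
    using e_add[of "- int j" "2 * int j"] by (simp add: algebra_simps)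
  also have "?t ^ n - 1 = (\<Sum>i<n. ?t ^ i) * (?t - 1)"
    using t by (simp add: geometric_sum)
  finally have "(e (int j) - e (- int j)) / (1 - ?t) = - (e (- int j) * (\<Sum>i<n. ?t ^ i))"
    using t by (simp add: field_simps)
  thus ?thesis
    by (simp add: R.uminus_closed R.mult_closed R.sum_closed R.power_closed e_in_coeff_ring theta_in_coeff_ring)
qed

text \<open>The quotient is the leading coefficient of the polynomial that interpolates column \<open>0\<close>.
  The number \<open>sqrt p\<close> agrees up to a fourth root of unity with the sine product, and the
  latter is divisible factor by factor.\<close>

lemma sqrt_p_div_in_coeff_ring:
  "sqrt_p / (\<Prod>j\<in>{1..r}. 1 - theta p (int j)) \<in> coeff_ring p"
proof -
  \<comment> \<open>Since \<open>y ^ 4 = 1\<close>, the inverse of \<open>y\<close> is \<open>y ^ 3\<close>, which stays in the ring.\<close>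
  define y where "y = sine_product / sqrt_p"
  have y: "y \<in> coeff_ring p" "y\<^sup>2 = (-1) ^ r"
    unfolding y_def using sine_product_square
    by (auto intro: div_sqrt_p_in_coeff_ring div_sqrt_p_square)
  have "y ^ 3 * y = (y\<^sup>2)\<^sup>2" by (simp add: eval_nat_numeral mult_ac)
  hence "y ^ 3 * y = 1" using y(2) by (simp flip: power_mult)
  moreover have "sine_product = y * sqrt_p" using sqrt_p_nonzero by (simp add: y_def)
  ultimately have "sqrt_p = y ^ 3 * sine_product" by (simp flip: mult.assoc)
  hence "sqrt_p / (\<Prod>j\<in>{1..r}. 1 - theta p (int j)) =
      y ^ 3 * (\<Prod>j\<in>{1..r}. (e (int j) - e (- int j)) / (1 - theta p (int j)))"
    by (simp add: sine_product_def prod_dividef)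
  also have "\<dots> \<in> coeff_ring p"
    by (intro R.mult_closed R.power_closed y(1) R.prod_closed sine_factor_div)
  finally show ?thesis .
qed

section \<open>The matrices in the Vandermonde basis\<close>

lemma zero_less_size: "0 < r + 1"
  by simp

lemma V_mat_eq: "V_mat p = vandermonde (r + 1) (\<lambda>j. theta p (int j))"
  by (simp add: V_mat_def vandermonde_def)

text \<open>Up to the factor \<open>1 / sqrt p\<close>, row \<open>j\<close> of \<open>S_mat p\<close> holds the values \<open>e (j * l)\<close>, with
  \<open>l\<close> and \<open>-l\<close> merged into one column. Undoing this merger gives a full quadratic
  exponential sum.\<close>

lemma S_times_V_entry:
  assumes j: "j < r + 1" and k: "k < r + 1"
  shows "(S_mat p * V_mat p) $$ (j, k) =
    (\<Sum>l\<in>{0..<int p}. e (int r * int k * l\<^sup>2 + int j * l)) / sqrt_p"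
proof -
  let ?F = "\<lambda>l. e (int r * int k * l\<^sup>2 + int j * l)"
  have theta_pow: "theta p l ^ k = e (int r * int k * l\<^sup>2)" for l
    unfolding theta_eq e_mult_nat[symmetric] by (simp only: mult_ac)
  have "(S_mat p * V_mat p) $$ (j, k) = (\<Sum>l = 0..<r + 1. S_mat p $$ (j, l) * theta p (int l) ^ k)"
    using j k by (simp add: S_mat_def V_mat_def scalar_prod_def)
  also have "{0..<r + 1} = insert 0 {1..r}" by auto
  also have "(\<Sum>l\<in>insert 0 {1..r}. S_mat p $$ (j, l) * theta p (int l) ^ k) =
      1 / sqrt_p + (\<Sum>l\<in>{1..r}. S_mat p $$ (j, l) * theta p (int l) ^ k)"
    using j by (simp add: S_mat_def theta_0)
  also have "(\<Sum>l\<in>{1..r}. S_mat p $$ (j, l) * theta p (int l) ^ k) =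
      (\<Sum>l\<in>{1..r}. (?F (int l) + ?F (- int l)) / sqrt_p)"
  proof (intro sum.cong refl)
    fix l assume l: "l \<in> {1..r}"
    have "S_mat p $$ (j, l) = (e (int j * int l) + e (- (int j * int l))) / sqrt_p"
      using j l by (auto simp: S_mat_def e_def)
    thus "S_mat p $$ (j, l) * theta p (int l) ^ k = (?F (int l) + ?F (- int l)) / sqrt_p"
      unfolding theta_pow e_add
      by (simp add: e_minus algebra_simps add_divide_distrib)
  qed
  also have "1 / sqrt_p + \<dots> = (\<Sum>l\<in>{0..<int p}. ?F l) / sqrt_p"
    using periodic_quadratic[of "int r * int k" "int j" 0]
    by (subst sum_fold) (simp_all add: e_0 add_divide_distrib sum_divide_distrib)
  finally show ?thesis .
qed

text \<open>For \<open>k = 0\<close> the column is \<open>sqrt p\<close> times the first unit vector, and its interpolating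
  polynomial vanishes at all \<open>theta p j\<close> with \<open>j \<ge> 1\<close>. For \<open>k \<ge> 1\<close>, completing the square
  shows that the column is a fourth root of unity times the column of powers
  \<open>theta p j ^ m\<close>, where \<open>m\<close> is \<open>- 1 / k\<close> modulo \<open>p\<close>.\<close>

lemma S_column_interpolation:
  assumes k: "k < r + 1"
  shows "\<exists>f. f \<in> R.polys_over \<and> degree f < r + 1 \<and>
    (\<forall>j<r + 1. (S_mat p * V_mat p) $$ (j, k) = poly f (theta p (int j)))"
proof (cases "k = 0")
  case True
  define P where "P = (\<Prod>j\<in>{1..r}. 1 - theta p (int j))"
  define f where "f = Polynomial.smult (sqrt_p / P) (\<Prod>j\<in>{1..r}. [:- theta p (int j), 1:])"
  have P: "P \<noteq> 0"
  proof -
    have "1 - theta p (int j) \<noteq> 0" if "j \<in> {1..r}" for j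
      using inj_onD[OF theta_inj, of j 0] that by (auto simp: theta_0)
    thus ?thesis unfolding P_def by (simp only: prod_zero_iff finite_atLeastAtMost) blast
  qed
  have "f \<in> R.polys_over"
    unfolding f_def P_def
    by (intro R.smult_over R.prod_linear_over sqrt_p_div_in_coeff_ring theta_in_coeff_ring)
  moreover have "degree f < r + 1"
    unfolding f_def by (rule le_less_trans[OF degree_smult_le]) (simp add: degree_prod_linear)
  moreover have "(S_mat p * V_mat p) $$ (j, k) = poly f (theta p (int j))" if j: "j < r + 1" for j
  proof (cases "j = 0")
    case j0: True
    have "(S_mat p * V_mat p) $$ (j, k) = of_nat p / sqrt_p"
      unfolding S_times_V_entry[OF j k] using True j0 by (simp add: e_0)
    also have "\<dots> = sqrt_p"
      using sqrt_p_nonzero sqrt_p_square by (simp add: power2_eq_square field_simps)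
    also have "\<dots> = poly f (theta p (int j))"
      using j0 P by (simp add: f_def P_def poly_prod theta_0)
    finally show ?thesis .
  next
    case False
    have "\<not> int p dvd int j" using False j p_eq by (intro not_dvd_between) auto
    hence "(S_mat p * V_mat p) $$ (j, k) = 0"
      unfolding S_times_V_entry[OF j k] using True by (simp add: sum_e)
    moreover have "poly f (theta p (int j)) = 0"
      using False j by (auto simp: f_def poly_prod)
    ultimately show ?thesis by simp
  qed
  ultimately show ?thesis by blast
next
  case False
  have k': "\<not> int p dvd int k" using False k p_eq by (intro not_dvd_between) auto
  hence rk: "\<not> int p dvd int r * int k"
    using r_not_dvd prime_int_p by (simp add: prime_dvd_mult_iff)
  obtain m where m: "[int k * int m = -1] (mod int p)" using solve_cong[OF k'] by blast
  have "2 * int r - (-1) = int p" using p_eq by linarith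
  hence two_r: "[2 * int r = -1] (mod int p)"
    by (simp only: cong_iff_dvd_diff dvd_refl)
  define a where "a = gauss_sum (int r * int k) / sqrt_p"
  have a: "a \<in> coeff_ring p"
    unfolding a_def by (intro div_sqrt_p_in_coeff_ring gauss_sum_square rk)
  obtain f where f: "f \<in> R.polys_over" "degree f < r + 1"
      "\<And>j. j < r + 1 \<Longrightarrow> poly f (theta p (int j)) = theta p (int j) ^ m"
    using reduce_monomial[OF subring_coeff_ring, of "r + 1" "\<lambda>j. theta p (int j)" m,
        OF theta_in_coeff_ring zero_less_size]
    by blast
  have "(S_mat p * V_mat p) $$ (j, k) = a * theta p (int j) ^ m" if j: "j < r + 1" for j
  proof -
    \<comment> \<open>As \<open>2 * r\<close> and \<open>k * m\<close> are both \<open>-1\<close>, the shift that completes the square is \<open>j * m\<close>.\<close>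
    have "[(2 * int r) * (int k * int m) * int j = (-1) * (-1) * int j] (mod int p)"
      by (intro cong_mult two_r m cong_refl)
    hence "[2 * (int r * int k) * (int j * int m) = int j] (mod int p)"
      by (simp add: mult_ac)
    from gauss_sum_completed_square[OF this]
    have "(S_mat p * V_mat p) $$ (j, k) = a * e (- (int r * int k * (int j * int m)\<^sup>2))"
      unfolding S_times_V_entry[OF j k] by (simp add: a_def)
    also have "e (- (int r * int k * (int j * int m)\<^sup>2)) = e (int r * (int j)\<^sup>2 * int m)"
    proof (rule e_cong)
      have "[- (int r * (int j)\<^sup>2 * int m) * (int k * int m) = - (int r * (int j)\<^sup>2 * int m) * (-1)] (mod int p)"
        by (intro cong_mult m cong_refl)
      thus "[- (int r * int k * (int j * int m)\<^sup>2) = int r * (int j)\<^sup>2 * int m] (mod int p)"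
        by (simp add: power2_eq_square mult_ac)
    qed
    also have "\<dots> = theta p (int j) ^ m" by (simp add: theta_eq e_mult_nat)
    finally show ?thesis .
  qed
  hence "\<forall>j<r + 1. (S_mat p * V_mat p) $$ (j, k) = poly (Polynomial.smult a f) (theta p (int j))"
    using f(3) by simp
  moreover have "Polynomial.smult a f \<in> R.polys_over" using a f(1) by (rule R.smult_over)
  moreover have "degree (Polynomial.smult a f) < r + 1"
    using degree_smult_le f(2) by (rule le_less_trans)
  ultimately show ?thesis by blast
qed

lemma T_times_V_entry:
  assumes "j < r + 1" "k < r + 1"
  shows "(T_mat p * V_mat p) $$ (j, k) = theta p (int j) ^ Suc k"
proof -
  have "V_mat p \<in> carrier_mat (r + 1) (r + 1)" by (simp add: V_mat_def)
  thus ?thesis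
    using assms by (simp add: T_mat_def mat_diag_mult_left) (simp add: V_mat_def theta_0)
qed

end

theorem claim1:
  fixes p :: nat
  assumes "prime p" and "odd p" and "p \<ge> 5"
  shows "\<exists>W \<in> carrier_mat (half_pred p + 1) (half_pred p + 1).
           inverts_mat (V_mat p) W \<and> inverts_mat W (V_mat p) \<and>
           elements_mat (W * S_mat p * V_mat p) \<subseteq> coeff_ring p \<and>
           elements_mat (W * T_mat p * V_mat p) \<subseteq> coeff_ring p"
proof -
  interpret odd_prime p by unfold_locales fact+
  let ?x = "\<lambda>j. theta p (int j)"
  have V: "V_mat p \<in> carrier_mat (r + 1) (r + 1)" by (simp add: V_mat_def)
  have S: "S_mat p \<in> carrier_mat (r + 1) (r + 1)" by (simp add: S_mat_def)
  have T: "T_mat p \<in> carrier_mat (r + 1) (r + 1)" by (simp add: T_mat_def mat_diag_def)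
  obtain W where W: "W \<in> carrier_mat (r + 1) (r + 1)"
      "vandermonde (r + 1) ?x * W = 1\<^sub>m (r + 1)" "W * vandermonde (r + 1) ?x = 1\<^sub>m (r + 1)"
    using vandermonde_inverse[OF theta_inj] by blast
  have "elements_mat (W * (S_mat p * V_mat p)) \<subseteq> coeff_ring p"
    by (rule elements_inverse_vandermonde_times
          [OF subring_coeff_ring W(1,3) mult_carrier_mat[OF S V] S_column_interpolation])
  moreover have "elements_mat (W * (T_mat p * V_mat p)) \<subseteq> coeff_ring p"
  proof (rule elements_inverse_vandermonde_times
           [OF subring_coeff_ring W(1,3) mult_carrier_mat[OF T V]])
    fix k assume "k < r + 1"
    thus "\<exists>f. f \<in> R.polys_over \<and> degree f < r + 1 \<and>
        (\<forall>j<r + 1. (T_mat p * V_mat p) $$ (j, k) = poly f (?x j))"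
      using reduce_monomial[OF subring_coeff_ring, of "r + 1" ?x "Suc k",
          OF theta_in_coeff_ring zero_less_size]
      by (simp only: T_times_V_entry eq_commute[of "poly _ _"] cong: all_cong) 
  qed
  ultimately show ?thesis
    using W V S T by (intro bexI[of _ W]) (simp_all add: inverts_mat_def V_mat_eq assoc_mult_mat)
qed

end
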